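(* Define polynomials $\Lambda_k$ in $\lambda$ by $\Lambda_1=\lambda$, $\Lambda_2=\lambda^2-\frac14$, and $\Lambda_k=\lambda\Lambda_{k-1}-\frac14\Lambda_{k-2}$ for every $k\ge 3$. Then for every integer $n\ge 5$, the Randić characteristic polynomial of the path graph $P_n$ on $n$ vertices satisfies $$RP(P_n,\lambda)=(\lambda^2-1)\left(\lambda\Lambda_{n-3}-\tfrac14\Lambda_{n-4}\right).$$
   Context: All graphs are finite and simple. For a graph $G$ with vertices $v_1,\dots,v_n$ of degrees $d_1,\dots,d_n$, the Randić matrix $R(G)$ is the $n\times n$ real symmetric matrix with $(i,j)$-entry $\frac{1}{\sqrt{d_id_j}}$ if $v_i$ and $v_j$ are adjacent, and $0$ otherwise. The Randić characteristic polynomial of $G$ is $RP(G,\lambda)=\det(\lambda I-R(G))$. *)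

theory Defs
  imports
    "Graph_Theory.Pair_Digraph"
    "Jordan_Normal_Form.Char_Poly"
    Complex_Main
begin

text \<open>
  A finite simple graph is represented as a \<^locale>\<open>pair_graph\<close>: each undirected edge is a pair
  of opposite arcs, so the degree of a vertex is its \<^const>\<open>out_degree\<close>.

  The vertices are listed in increasing order. A different enumeration conjugates the matrix by a
  permutation matrix and so does not change its characteristic polynomial.
\<close>

definition randic_matrix :: "'a::linorder pair_pre_digraph \<Rightarrow> real mat" where
  "randic_matrix G =
    (let n = card (pverts G);
         v = (\<lambda>i. sorted_list_of_set (pverts G) ! i);
         d = (\<lambda>i. real (out_degree (with_proj G) (v i)))
     in mat n n (\<lambda>(i, j). if (v i, v j) \<in> parcs G then 1 / sqrt (d i * d j) else 0))"

definition randic_char_poly :: "'a::linorder pair_pre_digraph \<Rightarrow> real poly" where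
  "randic_char_poly G = char_poly (randic_matrix G)"

definition path_graph :: "nat \<Rightarrow> nat pair_pre_digraph" where
  "path_graph n =
    \<lparr> pverts = {0..<n},
      parcs = {(i, j). i < n \<and> j < n \<and> (j = Suc i \<or> i = Suc j)} \<rparr>"

lemma pair_graph_path_graph: "pair_graph (path_graph n)"
proof
  show "finite (parcs (path_graph n))"
    by (rule finite_subset[of _ "{0..<n} \<times> {0..<n}"]) (auto simp: path_graph_def)
qed (auto simp: path_graph_def symmetric_def sym_def)

text \<open>The sequence starts at index 1; its value at 0 is unspecified.\<close>

fun Lambda_poly :: "nat \<Rightarrow> real poly" where
  "Lambda_poly (Suc 0) = [:0, 1:]"
| "Lambda_poly (Suc (Suc 0)) = [:0, 1:]\<^sup>2 - [:1/4:]"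
| "Lambda_poly (Suc (Suc (Suc k))) =
    [:0, 1:] * Lambda_poly (Suc (Suc k)) - [:1/4:] * Lambda_poly (Suc k)"

end

theory Submission
  imports Defs
begin

text \<open>
  The Randic matrix of a path is tridiagonal, so the leading principal minors \<open>E\<^sub>k\<close> of
  \<open>\<lambda>I - R\<close> satisfy a three-term recurrence with the squared edge weights as coefficients. These are
  \<open>1/4\<close> except at the two end edges, where they are \<open>1/2\<close>. Up to \<open>k = n - 1\<close> this is the recurrence of
  \<open>\<Lambda>\<close> with a perturbed start, giving \<open>E\<^sub>k = \<lambda>\<Lambda>\<^sub>k\<^sub>-\<^sub>1 - \<Lambda>\<^sub>k\<^sub>-\<^sub>2/2\<close>. The last step
  then yields \<open>\<lambda>\<^sup>2\<Lambda>\<^sub>n\<^sub>-\<^sub>2 - \<lambda>\<Lambda>\<^sub>n\<^sub>-\<^sub>3 + \<Lambda>\<^sub>n\<^sub>-\<^sub>4/4 = (\<lambda>\<^sup>2 - 1)\<Lambda>\<^sub>n\<^sub>-\<^sub>2\<close>.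
\<close>

text \<open>Both off-diagonals are indexed by the smaller of row and column, so \<open>b i\<close>
  and \<open>c i\<close> belong to the same edge between \<open>i\<close> and
  \<open>Suc i\<close>.\<close>

definition tridiag_mat ::
  "(nat \<Rightarrow> 'a::zero) \<Rightarrow> (nat \<Rightarrow> 'a) \<Rightarrow> (nat \<Rightarrow> 'a) \<Rightarrow> nat \<Rightarrow> 'a mat" where
  "tridiag_mat a b c n = mat n n (\<lambda>(i, j).
     if i = j then a i else if j = Suc i then b i else if i = Suc j then c j else 0)"

text \<open>Continuant recurrence: expand along the last row, then expand the minor
  \<open>?B\<close> of its off-diagonal entry along the last column, where only \<open>b n\<close>
  survives.\<close>

lemma det_tridiag_mat_Suc_Suc:
  fixes a b c :: "nat \<Rightarrow> 'a::comm_ring_1"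
  shows "det (tridiag_mat a b c (Suc (Suc n))) =
    a (Suc n) * det (tridiag_mat a b c (Suc n)) - b n * c n * det (tridiag_mat a b c n)"
proof -
  let ?A = "tridiag_mat a b c (Suc (Suc n))"
  let ?B = "mat_delete ?A (Suc n) n"
  have B: "?B \<in> carrier_mat (Suc n) (Suc n)"
    by (simp add: mat_delete_def tridiag_mat_def)
  have minor: "mat_delete ?A (Suc n) (Suc n) = tridiag_mat a b c (Suc n)"
    by (rule eq_matI) (auto simp: mat_delete_def tridiag_mat_def)
  have minor_B: "mat_delete ?B n n = tridiag_mat a b c n"
    by (rule eq_matI) (auto simp: mat_delete_def tridiag_mat_def)
  have B_col: "?B $$ (i, n) = (if i = n then b n else 0)" if "i < Suc n" for i
    using that by (auto simp: mat_delete_def tridiag_mat_def)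
  have "det ?B = (\<Sum>i<Suc n. ?B $$ (i, n) * cofactor ?B i n)"
    using laplace_expansion_column[OF B, of n] by simp
  also have "\<dots> = b n * cofactor ?B n n"
    by (simp add: B_col)
  also have "\<dots> = b n * det (tridiag_mat a b c n)"
    by (simp add: cofactor_def minor_B)
  finally have det_B: "det ?B = b n * det (tridiag_mat a b c n)" .
  have "det ?A = (\<Sum>j<Suc (Suc n). ?A $$ (Suc n, j) * cofactor ?A (Suc n) j)"
    using laplace_expansion_row[of ?A "Suc (Suc n)" "Suc n"] by (simp add: tridiag_mat_def)
  also have "\<dots> = c n * cofactor ?A (Suc n) n + a (Suc n) * cofactor ?A (Suc n) (Suc n)"
    by (simp add: tridiag_mat_def)
  also have "\<dots> = a (Suc n) * det (tridiag_mat a b c (Suc n)) - b n * c n * det (tridiag_mat a b c n)"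
    by (simp add: cofactor_def minor det_B)
  finally show ?thesis .
qed

lemma sorted_verts_path_graph: "sorted_list_of_set (pverts (path_graph n)) = [0..<n]"
  by (simp add: path_graph_def)

lemma out_degree_path_graph:
  assumes "i < n"
  shows "out_degree (with_proj (path_graph n)) i =
    (if 0 < i then 1 else 0) + (if Suc i < n then 1 else 0)"
proof -
  have "out_arcs (with_proj (path_graph n)) i =
      (if 0 < i then {(i, i - 1)} else {}) \<union> (if Suc i < n then {(i, Suc i)} else {})"
    using assms by (auto simp: out_arcs_def path_graph_def)
  then show ?thesis
    by (simp add: out_degree_def)
qed

definition path_weight :: "nat \<Rightarrow> nat \<Rightarrow> real" where
  "path_weight n i = (if i = 0 \<or> Suc (Suc i) = n then 1 / sqrt 2 else 1 / 2)"

text \<open>For \<open>n \<ge> 3\<close> an end edge joins degrees 1 and 2 and an inner edge joins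
  degrees 2 and 2. The bound excludes \<open>n = 2\<close>, whose single edge joins two leaves and
  has weight 1.\<close>

lemma randic_char_poly_path_graph:
  assumes "n \<ge> 3"
  shows "randic_char_poly (path_graph n) =
    det (tridiag_mat (\<lambda>_. [:0, 1:]) (\<lambda>i. - [:path_weight n i:]) (\<lambda>i. - [:path_weight n i:]) n)"
proof -
  let ?R = "randic_matrix (path_graph n)"
  let ?d = "\<lambda>i. real (out_degree (with_proj (path_graph n)) i)"
  have card: "card (pverts (path_graph n)) = n"
    by (simp add: path_graph_def)
  have entry: "?R $$ (i, j) = (if j = Suc i \<or> i = Suc j then 1 / sqrt (?d i * ?d j) else 0)"
    if "i < n" "j < n" for i j
  proof -
    have "[0..<n] ! i = i" "[0..<n] ! j = j"
      using that by simp_all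
    moreover have "(i, j) \<in> parcs (path_graph n) \<longleftrightarrow> j = Suc i \<or> i = Suc j"
      using that by (simp add: path_graph_def)
    ultimately show ?thesis
      using that by (simp add: randic_matrix_def Let_def card sorted_verts_path_graph)
  qed
  have weight: "1 / sqrt (?d i * ?d (Suc i)) = path_weight n i" if "Suc i < n" for i
    using that assms by (auto simp: out_degree_path_graph path_weight_def)
  have "?R = tridiag_mat (\<lambda>_. 0) (path_weight n) (path_weight n) n"
  proof (rule eq_matI)
    fix i j
    assume "i < dim_row (tridiag_mat (\<lambda>_. 0) (path_weight n) (path_weight n) n)"
      and "j < dim_col (tridiag_mat (\<lambda>_. 0) (path_weight n) (path_weight n) n)"
    then have "i < n" "j < n"
      by (simp_all add: tridiag_mat_def)
    then show "?R $$ (i, j) = tridiag_mat (\<lambda>_. 0) (path_weight n) (path_weight n) n $$ (i, j)"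
      using weight[of i] weight[of j] by (auto simp: entry tridiag_mat_def mult.commute)
  qed (simp_all add: randic_matrix_def Let_def card tridiag_mat_def)
  moreover have "char_poly_matrix (tridiag_mat (\<lambda>_. 0) (path_weight n) (path_weight n) n) =
      tridiag_mat (\<lambda>_. [:0, 1:]) (\<lambda>i. - [:path_weight n i:]) (\<lambda>i. - [:path_weight n i:]) n"
    by (intro eq_matI) (auto simp: char_poly_matrix_def tridiag_mat_def)
  ultimately show ?thesis
    by (simp add: randic_char_poly_def char_poly_def)
qed

theorem theorem1:
  fixes n :: nat
  assumes "n \<ge> 5"
  shows "randic_char_poly (path_graph n) =
    ([:0, 1:]\<^sup>2 - 1) *
    ([:0, 1:] * Lambda_poly (n - 3) - [:1/4:] * Lambda_poly (n - 4))"
proof -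
  define x where "x = [:0, 1::real:]"
  define h where "h = [:1/2::real:]"
  define q where "q = [:1/4::real:]"
  define w where "w = (\<lambda>i. - [:path_weight n i:])"
  \<comment> \<open>\<open>w\<close> keeps the weights of the full path, so \<open>E k\<close> with
    \<open>k < n\<close> is not the polynomial of a shorter path: the far end edge enters only in
    the step to \<open>E n\<close>.\<close>
  define E where "E k = det (tridiag_mat (\<lambda>_. x) w w k)" for k
  have E_rec: "E (Suc (Suc k)) = x * E (Suc k) - w k * w k * E k" for k
    by (simp add: E_def det_tridiag_mat_Suc_Suc)
  have E_0: "E 0 = 1"
    by (simp add: E_def tridiag_mat_def)
  have E_1: "E (Suc 0) = x"
    by (simp add: E_def tridiag_mat_def det_single)
  have w_end: "w i * w i = h" if "i = 0 \<or> Suc (Suc i) = n" for i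
    using that by (simp add: w_def path_weight_def h_def)
  have w_inner: "w i * w i = q" if "0 < i" "Suc (Suc i) < n" for i
    using that by (simp add: w_def path_weight_def q_def)
  have h: "h + h = 1" "h * h = q"
    by (simp_all add: h_def q_def one_pCons)
  have Lambda_rec: "Lambda_poly (Suc (Suc (Suc k))) =
      x * Lambda_poly (Suc (Suc k)) - q * Lambda_poly (Suc k)" for k
    by (simp add: x_def q_def)
  have E_2: "E (Suc (Suc 0)) = x\<^sup>2 - h"
    by (simp add: E_rec[of 0] E_0 E_1 w_end power2_eq_square)
  have E_inner: "E (Suc (Suc (Suc k))) = x * E (Suc (Suc k)) - q * E (Suc k)"
    if "Suc (Suc (Suc k)) < n" for k
    using that by (simp add: E_rec[of "Suc k"] w_inner)
  have Lambda_1: "Lambda_poly (Suc 0) = x" and Lambda_2: "Lambda_poly (Suc (Suc 0)) = x\<^sup>2 - q"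
    by (simp_all add: x_def q_def)
  have E_Lambda: "E (Suc (Suc (Suc k))) =
      x * Lambda_poly (Suc (Suc k)) - h * Lambda_poly (Suc k)"
    if "Suc (Suc (Suc k)) < n" for k
    using that
  \<comment> \<open>Both sides obey the same recurrence; two base cases are needed because
    \<open>Lambda_rec\<close> applies only from index 3 on.\<close>
  proof (induction k rule: induct_nat_012)
    case 0
    show ?case
      unfolding E_inner[OF 0] E_2 E_1 Lambda_1 Lambda_2 by (simp add: algebra_simps power2_eq_square)
  next
    case 1
    then have lt: "Suc (Suc (Suc 0)) < n"
      by simp
    show ?case
      unfolding E_inner[OF 1] E_inner[OF lt] E_2 E_1 Lambda_rec Lambda_1 Lambda_2
      by (simp add: algebra_simps power2_eq_square)
  next
    case (ge2 k)
    have IH: "E (Suc (Suc (Suc k))) = x * Lambda_poly (Suc (Suc k)) - h * Lambda_poly (Suc k)"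
      "E (Suc (Suc (Suc (Suc k)))) = x * Lambda_poly (Suc (Suc (Suc k))) - h * Lambda_poly (Suc (Suc k))"
      using ge2 by simp_all
    show ?case
      unfolding E_inner[OF ge2.prems] IH Lambda_rec by (simp add: algebra_simps power2_eq_square)
  qed
  \<comment> \<open>Now \<open>n - 4\<close> is \<open>Suc m\<close>, so the unspecified
    \<open>Lambda_poly 0\<close> never occurs.\<close>
  obtain m where n: "n = Suc (Suc (Suc (Suc (Suc m))))"
    using assms by (auto simp: numeral_eq_Suc Suc_le_eq dest: less_imp_Suc_add)
  have "randic_char_poly (path_graph n) = E n"
    using assms by (simp add: randic_char_poly_path_graph E_def x_def w_def)
  also have "\<dots> = x * E (Suc (Suc (Suc (Suc m)))) - h * E (Suc (Suc (Suc m)))"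
    by (simp add: n E_rec[of "Suc (Suc (Suc m))"] w_end)
  also have "\<dots> = (x\<^sup>2 - 1) * (x * Lambda_poly (Suc (Suc m)) - q * Lambda_poly (Suc m))"
  proof -
    have E_m: "E (Suc (Suc (Suc m))) = x * Lambda_poly (Suc (Suc m)) - h * Lambda_poly (Suc m)"
      "E (Suc (Suc (Suc (Suc m)))) =
        x * (x * Lambda_poly (Suc (Suc m)) - q * Lambda_poly (Suc m)) - h * Lambda_poly (Suc (Suc m))"
      using E_Lambda[of m] E_Lambda[of "Suc m"] n unfolding Lambda_rec by simp_all
    \<comment> \<open>\<open>h\<close> is kept opaque and grouped so that \<open>h + h = 1\<close>
      and \<open>h * h = q\<close> can be substituted; the last two terms then become minus the
      bracket.\<close>
    have "x * E (Suc (Suc (Suc (Suc m)))) - h * E (Suc (Suc (Suc m))) =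
        x\<^sup>2 * (x * Lambda_poly (Suc (Suc m)) - q * Lambda_poly (Suc m))
        - (h + h) * (x * Lambda_poly (Suc (Suc m))) + h * h * Lambda_poly (Suc m)"
      unfolding E_m by (simp add: algebra_simps power2_eq_square)
    then show ?thesis
      unfolding h by (simp add: algebra_simps)
  qed
  finally show ?thesis
    by (simp add: n x_def q_def)
qed

end
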